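(* Let $X_1,X_2,Y_1,Y_2$ be non-negative random variables with distributions $F_1,F_2,G_1,G_2$ respectively, all from the class $\mathcal{C}$, and suppose that they are generalized tail asymptotically independent (GTAI). If $(X_k,Y_l)\in\mathcal{C}^{(2)}$ for all $k,l\in\{1,2\}$, then $$\mathbf{P}[X_1+X_2>x,\ Y_1+Y_2>y]\sim\sum_{k=1}^2\sum_{l=1}^2\mathbf{P}[X_k>x,\ Y_l>y],\qquad x\wedge y\to\infty.$$ If, further, $X_1,X_2$ are tail asymptotically independent (TAI) and $Y_1,Y_2$ are TAI, then $(X_1+X_2,\,Y_1+Y_2)\in\mathcal{C}^{(2)}$.
   Context: Notation: $x\wedge y=\min\{x,y\}$; $f(x,y)\sim g(x,y)$ as $x\wedge y\to\infty$ means $\lim_{x\wedge y\to\infty} f(x,y)/g(x,y)=1$. For a distribution $F$, $\overline F=1-F$; all distributions satisfy $\overline F(x)>0$ for all $x\ge 0$. Joint tails appearing in denominators or as conditioning events are implicitly assumed positive. $F\in\mathcal{C}$ (consistently varying) if $\lim_{z\uparrow1}\limsup_{x\to\infty}\overline F(zx)/\overline F(x)=1$. A random pair $(X,Y)$ with marginal distributions $F,G$ belongs to $\mathcal{C}^{(2)}$ if $F\in\mathcal{C}$, $G\in\mathcal{C}$ and $\lim_{(z_1,z_2)\uparrow(1,1)}\limsup_{x\wedge y\to\infty}\mathbf{P}[X>z_1x,Y>z_2y]/\mathbf{P}[X>x,Y>y]=1$. GTAI: $X_1,\ldots,X_n,Y_1,\ldots,Y_m$ are GTAI if (1) $\lim_{\min\{x_i,x_k,y_j\}\to\infty}\mathbf{P}[|X_i|>x_i\mid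 X_k>x_k,Y_j>y_j]=0$ for all $1\le i\ne k\le n$, $1\le j\le m$; and (2) $\lim_{\min\{x_i,y_k,y_j\}\to\infty}\mathbf{P}[|Y_j|>y_j\mid X_i>x_i,Y_k>y_k]=0$ for all $1\le j\ne k\le m$, $1\le i\le n$. Here $n=m=2$. TAI: $X_1,\ldots,X_n$ are TAI if $\lim_{x_i\wedge x_j\to\infty}\mathbf{P}[|X_i|>x_i\mid X_j>x_j]=0$ for all $i\ne j$ in $\{1,\ldots,n\}$. *)

theory Defs
  imports "HOL-Probability.Probability" "HOL-Library.Landau_Symbols"
begin

text \<open>
  The limit \<open>x \<and> y \<rightarrow> \<infinity>\<close> (minimum of the arguments tending to infinity) is the
  product filter \<open>at_top \<times>\<^sub>F at_top\<close>, and analogously for three arguments.  Upper limits are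
  taken in the extended reals, so that they always exist.
\<close>

definition tail :: "real measure \<Rightarrow> real \<Rightarrow> real" where
  "tail F x = 1 - cdf F x"

definition consistently_varying :: "real measure \<Rightarrow> bool" where
  "consistently_varying F \<longleftrightarrow>
     real_distribution F \<and>
     (\<forall>x\<ge>0. tail F x > 0) \<and>
     ((\<lambda>z. Limsup at_top (\<lambda>x. ereal (tail F (z * x) / tail F x))) \<longlongrightarrow> 1) (at_left 1)"

definition joint_tail :: "'a measure \<Rightarrow> ('a \<Rightarrow> real) \<Rightarrow> ('a \<Rightarrow> real) \<Rightarrow> real \<Rightarrow> real \<Rightarrow> real" where
  "joint_tail M X Y x y = \<P>(\<omega> in M. X \<omega> > x \<and> Y \<omega> > y)"

text \<open>The class \<open>\<C>\<^sup>(\<^sup>2\<^sup>)\<close>.  Positivity of the joint tail is the standing convention for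
  denominators.\<close>

definition consistently_varying2 :: "'a measure \<Rightarrow> ('a \<Rightarrow> real) \<Rightarrow> ('a \<Rightarrow> real) \<Rightarrow> bool" where
  "consistently_varying2 M X Y \<longleftrightarrow>
     consistently_varying (distr M borel X) \<and>
     consistently_varying (distr M borel Y) \<and>
     (\<forall>x\<ge>0. \<forall>y\<ge>0. joint_tail M X Y x y > 0) \<and>
     ((\<lambda>(z\<^sub>1, z\<^sub>2). Limsup (at_top \<times>\<^sub>F at_top)
          (\<lambda>(x, y). ereal (joint_tail M X Y (z\<^sub>1 * x) (z\<^sub>2 * y) / joint_tail M X Y x y)))
        \<longlongrightarrow> 1) (at_left 1 \<times>\<^sub>F at_left 1)"

text \<open>Since \<open>cond_prob\<close> is \<open>0\<close> when the conditioning event is null, the standing convention that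
  conditioning events have positive probability is part of the next two definitions.  The families
  are indexed from \<open>1\<close>.\<close>

definition GTAI ::
  "'a measure \<Rightarrow> nat \<Rightarrow> (nat \<Rightarrow> 'a \<Rightarrow> real) \<Rightarrow> nat \<Rightarrow> (nat \<Rightarrow> 'a \<Rightarrow> real) \<Rightarrow> bool" where
  "GTAI M n X m Y \<longleftrightarrow>
     (\<forall>i\<in>{1..n}. \<forall>j\<in>{1..m}. \<forall>x\<ge>0. \<forall>y\<ge>0. \<P>(\<omega> in M. X i \<omega> > x \<and> Y j \<omega> > y) > 0) \<and>
     (\<forall>i\<in>{1..n}. \<forall>k\<in>{1..n}. \<forall>j\<in>{1..m}. i \<noteq> k \<longrightarrow>
        ((\<lambda>(x\<^sub>i, x\<^sub>k, y\<^sub>j). \<P>(\<omega> in M. \<bar>X i \<omega>\<bar> > x\<^sub>i \<bar> X k \<omega> > x\<^sub>k \<and> Y j \<omega> > y\<^sub>j)) \<longlongrightarrow> 0)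
          (at_top \<times>\<^sub>F at_top \<times>\<^sub>F at_top)) \<and>
     (\<forall>j\<in>{1..m}. \<forall>k\<in>{1..m}. \<forall>i\<in>{1..n}. j \<noteq> k \<longrightarrow>
        ((\<lambda>(x\<^sub>i, y\<^sub>k, y\<^sub>j). \<P>(\<omega> in M. \<bar>Y j \<omega>\<bar> > y\<^sub>j \<bar> X i \<omega> > x\<^sub>i \<and> Y k \<omega> > y\<^sub>k)) \<longlongrightarrow> 0)
          (at_top \<times>\<^sub>F at_top \<times>\<^sub>F at_top))"

definition TAI :: "'a measure \<Rightarrow> nat \<Rightarrow> (nat \<Rightarrow> 'a \<Rightarrow> real) \<Rightarrow> bool" where
  "TAI M n X \<longleftrightarrow>
     (\<forall>i\<in>{1..n}. \<forall>x\<ge>0. \<P>(\<omega> in M. X i \<omega> > x) > 0) \<and>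
     (\<forall>i\<in>{1..n}. \<forall>j\<in>{1..n}. i \<noteq> j \<longrightarrow>
        ((\<lambda>(x\<^sub>i, x\<^sub>j). \<P>(\<omega> in M. \<bar>X i \<omega>\<bar> > x\<^sub>i \<bar> X j \<omega> > x\<^sub>j)) \<longlongrightarrow> 0) (at_top \<times>\<^sub>F at_top))"

end

theory Submission
  imports Defs
begin

text \<open>
  The principle behind both claims is that of a single big jump in each coordinate.  Write \<open>S\<close> for
  the joint tail of the two sums, \<open>T\<close> for the sum of the four joint tails, and \<open>E\<close> for the
  total probability of the events that two given summands of one coordinate and one given summand
  of the other are large.  Non-negativity and inclusion-exclusion give \<open>T \<le> S + E\<close>
  (\<open>joint_tail_sum_le\<close>).  Conversely, if a sum of two numbers exceeds \<open>x\<close>, then one of them exceeds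
  \<open>z x\<close> or both exceed \<open>(1 - z) x\<close>; hence \<open>S p \<le> T (z p) + E (c p)\<close> for small \<open>c\<close>
  (\<open>joint_tail_of_sums_le\<close>).  Generalized tail asymptotic independence makes
  \<open>E = o(T)\<close> (\<open>joint_tail_overlap_smallo\<close>).

  Consistent variation is used through one estimate: \<open>T (z p) \<le> (1 + e) T p\<close> for \<open>z\<close> close to \<open>1\<close>
  and large \<open>p\<close>.  For \<open>z\<close> near \<open>1\<close> it makes \<open>T (z p)\<close> harmless, and iterated finitely often it shows
  \<open>T (c p) = O(T p)\<close> for a power \<open>c\<close> of \<open>z\<close>, so that \<open>E (c p) = o(T p)\<close>.  This yields \<open>S \<sim> T\<close>
  (\<open>asymp_equiv_if_dilation_sandwich\<close>).  The estimate passes to sums and along asymptotic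
  equivalence, hence from the joint tails to \<open>T\<close> and from \<open>T\<close> to \<open>S\<close>, which is the joint half of
  the second claim.  The marginals of the sums are treated by the same argument in one dimension,
  with \<open>TAI\<close> in place of \<open>GTAI\<close>; to serve both cases, the analytic part is stated for a
  filter on a real vector space.
\<close>

section \<open>Stability of tails under small dilations\<close>

text \<open>
  Consistent variation without upper limits.  The dilations \<open>s z\<close> are indexed by a parameter whose
  filter \<open>Z\<close> expresses convergence of \<open>s z\<close> to the identity: the parameter is one factor for tails,
  and a factor for each coordinate for joint tails.
\<close>

definition dilation_stable ::
  "'z filter \<Rightarrow> ('z \<Rightarrow> 'b \<Rightarrow> 'b) \<Rightarrow> 'b filter \<Rightarrow> ('b \<Rightarrow> real) \<Rightarrow> bool" where
  "dilation_stable Z s \<F> T \<longleftrightarrow>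
     (\<forall>e>0. \<forall>\<^sub>F z in Z. \<forall>\<^sub>F p in \<F>. T (s z p) \<le> (1 + e) * T p)"

lemma dilation_stable_add:
  assumes "dilation_stable Z s \<F> T" "dilation_stable Z s \<F> U"
  shows "dilation_stable Z s \<F> (\<lambda>p. T p + U p)"
  unfolding dilation_stable_def
proof (intro allI impI)
  fix e :: real assume "e > 0"
  then have "\<forall>\<^sub>F z in Z. \<forall>\<^sub>F p in \<F>. T (s z p) \<le> (1 + e) * T p"
    and "\<forall>\<^sub>F z in Z. \<forall>\<^sub>F p in \<F>. U (s z p) \<le> (1 + e) * U p"
    using assms by (auto simp: dilation_stable_def)
  then show "\<forall>\<^sub>F z in Z. \<forall>\<^sub>F p in \<F>. T (s z p) + U (s z p) \<le> (1 + e) * (T p + U p)"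
  proof eventually_elim
    case (elim z)
    then show ?case
      by eventually_elim (simp add: distrib_left)
  qed
qed

lemma dilation_stable_sum:
  assumes "\<And>i. i \<in> I \<Longrightarrow> dilation_stable Z s \<F> (T i)"
  shows "dilation_stable Z s \<F> (\<lambda>p. \<Sum>i\<in>I. T i p)"
proof (cases "finite I")
  case True
  then show ?thesis
    using assms
  proof (induction I)
    case empty
    then show ?case by (simp add: dilation_stable_def)
  next
    case (insert i I)
    then show ?case by (simp add: dilation_stable_add)
  qed
qed (simp add: dilation_stable_def)

text \<open>
  Asymptotic equivalence may be used at \<open>p\<close> and at the dilated point \<open>s z p\<close>, because \<open>s z p\<close> is
  large when \<open>p\<close> is.
\<close>

lemma dilation_stable_asymp_equiv:
  assumes equiv: "S \<sim>[\<F>] T" and pos: "\<forall>\<^sub>F p in \<F>. T p > 0"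
    and dil: "\<forall>\<^sub>F z in Z. filterlim (s z) \<F> \<F>"
    and stable: "dilation_stable Z s \<F> T"
  shows "dilation_stable Z s \<F> S"
  unfolding dilation_stable_def
proof (intro allI impI)
  fix e :: real assume e: "e > 0"
  \<comment> \<open>Two factors \<open>1 + d\<close> and a factor \<open>1 / (1 - d)\<close> accumulate below; this \<open>d\<close> keeps their
    product at most \<open>1 + e\<close>.\<close>
  define d where "d = min (1/2) (e / 8)"
  have d: "0 < d" "d \<le> 1/2" "d \<le> e / 8" using e by (auto simp: d_def)
  have K: "(1 + d) * (1 + d) \<le> (1 + e) * (1 - d)"
  proof -
    have "d * d \<le> d * (1/2)" "e * d \<le> e * (1/2)"
      using d e by (auto intro!: mult_left_mono)
    moreover have "(1 + e) * (1 - d) - (1 + d) * (1 + d) = e - 3 * d - d * d - e * d"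
      by (simp add: algebra_simps)
    ultimately show ?thesis using d e by linarith
  qed
  have "((\<lambda>p. S p / T p) \<longlongrightarrow> 1) \<F>"
    using equiv by (rule asymp_equivD_strong) (use pos in \<open>auto elim: eventually_mono\<close>)
  then have "\<forall>\<^sub>F p in \<F>. dist (S p / T p) 1 < d"
    using d(1) by (rule tendstoD)
  then have close: "\<forall>\<^sub>F p in \<F>. S p \<le> (1 + d) * T p \<and> (1 - d) * T p \<le> S p"
    using pos by eventually_elim (auto simp: dist_real_def abs_less_iff field_simps)
  have "\<forall>\<^sub>F z in Z. \<forall>\<^sub>F p in \<F>. T (s z p) \<le> (1 + d) * T p"
    using stable d(1) by (auto simp: dilation_stable_def)
  then show "\<forall>\<^sub>F z in Z. \<forall>\<^sub>F p in \<F>. S (s z p) \<le> (1 + e) * S p"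
    using dil
  proof eventually_elim
    case (elim z)
    have "\<forall>\<^sub>F p in \<F>. S (s z p) \<le> (1 + d) * T (s z p)"
      using eventually_compose_filterlim[OF close elim(2)] by eventually_elim simp
    then show ?case
      using elim(1) close pos
    proof eventually_elim
      case (elim p)
      have "S (s z p) \<le> (1 + d) * ((1 + d) * T p)"
        using elim(1,2) d by (meson add_nonneg_nonneg less_imp_le mult_left_mono order_trans zero_le_one)
      also have "\<dots> \<le> (1 + e) * ((1 - d) * T p)"
        using mult_right_mono[OF K, of "T p"] elim(4) by (simp add: mult.assoc)
      also have "\<dots> \<le> (1 + e) * S p"
        using elim(3) e by (intro mult_left_mono) auto
      finally show ?case .
    qed
  qed
qed

lemma dilation_stable_if_limsup_ratio:
  assumes lim: "((\<lambda>z. Limsup \<F> (\<lambda>p. ereal (T (s z p) / T p))) \<longlongrightarrow> 1) Z"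
    and pos: "\<forall>\<^sub>F p in \<F>. T p > 0"
  shows "dilation_stable Z s \<F> T"
  unfolding dilation_stable_def
proof (intro allI impI)
  fix e :: real assume "e > 0"
  then have "1 < ereal (1 + e)" by simp
  from order_tendstoD(2)[OF lim this]
  show "\<forall>\<^sub>F z in Z. \<forall>\<^sub>F p in \<F>. T (s z p) \<le> (1 + e) * T p"
  proof eventually_elim
    case (elim z)
    from Limsup_lessD[OF this] pos show ?case
      by eventually_elim (simp add: field_simps)
  qed
qed

text \<open>
  The upper limits are at least \<open>1\<close> because tails decrease, so only the upper bound depends on the
  stability.
\<close>

lemma limsup_ratio_if_dilation_stable:
  assumes stable: "dilation_stable Z s \<F> T"
    and pos: "\<forall>\<^sub>F p in \<F>. T p > 0"
    and anti: "\<forall>\<^sub>F z in Z. \<forall>\<^sub>F p in \<F>. T p \<le> T (s z p)"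
    and "\<F> \<noteq> bot"
  shows "((\<lambda>z. Limsup \<F> (\<lambda>p. ereal (T (s z p) / T p))) \<longlongrightarrow> 1) Z"
proof (rule order_tendstoI)
  fix a :: ereal assume a: "a < 1"
  from anti show "\<forall>\<^sub>F z in Z. a < Limsup \<F> (\<lambda>p. ereal (T (s z p) / T p))"
  proof eventually_elim
    case (elim z)
    have "1 \<le> Limsup \<F> (\<lambda>p. ereal (T (s z p) / T p))"
      using \<open>\<F> \<noteq> bot\<close>
    proof (rule le_Limsup)
      from elim pos show "\<forall>\<^sub>F p in \<F>. 1 \<le> ereal (T (s z p) / T p)"
        by eventually_elim simp
    qed
    with a show ?case by (rule less_le_trans)
  qed
next
  fix a :: ereal assume "1 < a"
  then obtain r where r: "1 < ereal r" "ereal r < a"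
    using ereal_dense2 by blast
  then have "r - 1 > 0" by simp
  with stable have "\<forall>\<^sub>F z in Z. \<forall>\<^sub>F p in \<F>. T (s z p) \<le> (1 + (r - 1)) * T p"
    unfolding dilation_stable_def by blast
  then show "\<forall>\<^sub>F z in Z. Limsup \<F> (\<lambda>p. ereal (T (s z p) / T p)) < a"
  proof eventually_elim
    case (elim z)
    have "Limsup \<F> (\<lambda>p. ereal (T (s z p) / T p)) \<le> ereal r"
    proof (rule Limsup_bounded)
      from elim pos show "\<forall>\<^sub>F p in \<F>. ereal (T (s z p) / T p) \<le> ereal r"
        by eventually_elim (simp add: field_simps)
    qed
    from this r(2) show ?case by (rule le_less_trans)
  qed
qed

text \<open>
  The lower bound of the sandwich differs from \<open>T\<close> by \<open>o(T)\<close>.  In the upper bound, \<open>z\<close> close to \<open>1\<close>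
  makes the first term at most \<open>(1 + e) T p\<close>.  The second term is \<open>o(T (c p))\<close>, and stability alone
  gives \<open>T (c p) = O(T p)\<close> once \<open>c\<close> is a power of the same \<open>z\<close>.
\<close>

lemma asymp_equiv_if_dilation_sandwich:
  fixes \<F> :: "'b::real_vector filter" and S T E :: "'b \<Rightarrow> real"
  assumes dil: "\<And>z. z > 0 \<Longrightarrow> filterlim (scaleR z) \<F> \<F>"
    and pos: "\<forall>\<^sub>F p in \<F>. T p > 0"
    and stable: "dilation_stable (at_left 1) scaleR \<F> T"
    and small: "E \<in> o[\<F>](T)"
    and lower: "\<forall>\<^sub>F p in \<F>. T p \<le> S p + E p"
    and upper: "\<And>z c. 0 < z \<Longrightarrow> z < 1 \<Longrightarrow> 0 < c \<Longrightarrow> c \<le> z \<Longrightarrow> c \<le> 1 - z \<Longrightarrow>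
                  \<forall>\<^sub>F p in \<F>. S p \<le> T (z *\<^sub>R p) + E (c *\<^sub>R p)"
  shows "S \<sim>[\<F>] T"
proof (rule asymp_equivI', rule tendstoI)
  fix e :: real assume e: "e > 0"
  define K where "K = 1 + e / 3"
  have K: "K > 0" using e by (simp add: K_def)
  have "e / 3 > 0" using e by simp
  then have "\<forall>\<^sub>F z in at_left 1. \<forall>\<^sub>F p in \<F>. T (z *\<^sub>R p) \<le> K * T p"
    using stable unfolding dilation_stable_def K_def by blast
  moreover have "\<forall>\<^sub>F z in at_left (1::real). z \<in> {0<..<1}"
    by (rule eventually_at_left_real) simp
  ultimately have "\<forall>\<^sub>F z in at_left 1. (\<forall>\<^sub>F p in \<F>. T (z *\<^sub>R p) \<le> K * T p) \<and> z \<in> {0<..<1}"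
    by (rule eventually_conj)
  from eventually_happens'[OF trivial_limit_at_left_real this]
  obtain z :: real where z: "0 < z" "z < 1" and Tz: "\<forall>\<^sub>F p in \<F>. T (z *\<^sub>R p) \<le> K * T p"
    by auto
  \<comment> \<open>The role of \<open>c\<close> is played by \<open>z ^ n\<close>, which lets the one-step bound be iterated.\<close>
  obtain n where "z ^ n < 1 - z"
    using real_arch_pow_inv[of "1 - z" z] z by auto
  moreover from this z have "n \<noteq> 0" by (intro notI) simp
  ultimately have c: "z ^ n \<le> 1 - z" "z ^ n \<le> z" "0 < z ^ n"
    using z power_decreasing[of 1 n z] by auto
  have dom: "\<forall>\<^sub>F p in \<F>. T (z ^ m *\<^sub>R p) \<le> K ^ m * T p" for m
  proof (induction m)
    case (Suc m)
    have "\<forall>\<^sub>F p in \<F>. T (z ^ m *\<^sub>R z *\<^sub>R p) \<le> K ^ m * T (z *\<^sub>R p)"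
      by (rule eventually_compose_filterlim[OF Suc dil[OF z(1)]])
    then show ?case
      using Tz
    proof eventually_elim
      case (elim p)
      have "K ^ m * T (z *\<^sub>R p) \<le> K ^ m * (K * T p)"
        using elim(2) K by (intro mult_left_mono) auto
      with elim(1) show ?case by (simp add: mult_ac)
    qed
  qed simp
  define d where "d = e / (3 * K ^ n)"
  have d: "d > 0" using e K by (simp add: d_def)
  have "\<forall>\<^sub>F p in \<F>. norm (E p) \<le> d * norm (T p)"
    using landau_o.smallD[OF small d] by simp
  then have "\<forall>\<^sub>F p in \<F>. norm (E (z ^ n *\<^sub>R p)) \<le> d * norm (T (z ^ n *\<^sub>R p))"
    by (rule eventually_compose_filterlim[OF _ dil[OF c(3)]])
  moreover have "\<forall>\<^sub>F p in \<F>. norm (E p) \<le> e / 2 * norm (T p)"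
    using landau_o.smallD[OF small, of "e / 2"] e by simp
  moreover have "\<forall>\<^sub>F p in \<F>. T (z ^ n *\<^sub>R p) > 0"
    by (rule eventually_compose_filterlim[OF pos dil[OF c(3)]])
  ultimately show "\<forall>\<^sub>F p in \<F>. dist (S p / T p) 1 < e"
    using upper[OF z c(3,2,1)] lower Tz dom[of n] pos
  proof eventually_elim
    case (elim p)
    have "E (z ^ n *\<^sub>R p) \<le> d * T (z ^ n *\<^sub>R p)" using elim(1,3) by simp
    also have "\<dots> \<le> d * (K ^ n * T p)" using elim(7) d by (intro mult_left_mono) auto
    also have "\<dots> = e / 3 * T p" using K by (simp add: d_def)
    finally have "S p \<le> K * T p + e / 3 * T p" using elim(4,6) by linarith
    then have "S p - T p \<le> 2 / 3 * (e * T p)" by (simp add: K_def algebra_simps)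
    moreover have "T p - S p \<le> 1 / 2 * (e * T p)" using elim(2,5,8) by simp
    moreover have "e * T p > 0" using e elim(8) by simp
    ultimately have "\<bar>S p - T p\<bar> < e * T p" by linarith
    moreover have "S p / T p - 1 = (S p - T p) / T p" using elim(8) by (simp add: field_simps)
    ultimately show ?case using elim(8) by (simp add: dist_real_def pos_divide_less_eq)
  qed
qed

section \<open>Tail probabilities\<close>

context prob_space
begin

lemma tail_distr:
  assumes [measurable]: "X \<in> borel_measurable M"
  shows "tail (distr M borel X) x = \<P>(\<omega> in M. X \<omega> > x)"
proof -
  have "tail (distr M borel X) x = 1 - prob {\<omega> \<in> space M. X \<omega> \<le> x}"
    by (simp add: tail_def cdf_def measure_distr vimage_def Int_def conj_commute)
  also have "\<dots> = prob (space M - {\<omega> \<in> space M. X \<omega> \<le> x})"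
    by (subst prob_compl) auto
  also have "space M - {\<omega> \<in> space M. X \<omega> \<le> x} = {\<omega> \<in> space M. X \<omega> > x}"
    by auto
  finally show ?thesis .
qed

lemma prob_eq_expectation_of_bool:
  assumes [measurable]: "Measurable.pred M P"
  shows "\<P>(\<omega> in M. P \<omega>) = expectation (\<lambda>\<omega>. of_bool (P \<omega>))"
    and "integrable M (\<lambda>\<omega>. of_bool (P \<omega>) :: real)"
proof -
  have *: "of_bool (P \<omega>) = (indicator {\<omega> \<in> space M. P \<omega>} \<omega> :: real)" if "\<omega> \<in> space M" for \<omega>
    using that by (simp add: indicator_def)
  show "\<P>(\<omega> in M. P \<omega>) = expectation (\<lambda>\<omega>. of_bool (P \<omega>))"
    by (subst Bochner_Integration.integral_cong[OF refl *]) auto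
  show "integrable M (\<lambda>\<omega>. of_bool (P \<omega>) :: real)"
    by (rule integrable_const_bound[where B = 1]) auto
qed

lemma sum_list_prob_eq_expectation:
  assumes "list_all (Measurable.pred M) Ps"
  shows "(\<Sum>P\<leftarrow>Ps. \<P>(\<omega> in M. P \<omega>)) = expectation (\<lambda>\<omega>. \<Sum>P\<leftarrow>Ps. of_bool (P \<omega>))
    \<and> integrable M (\<lambda>\<omega>. \<Sum>P\<leftarrow>Ps. of_bool (P \<omega>) :: real)"
  using assms by (induction Ps) (simp_all add: prob_eq_expectation_of_bool)

text \<open>
  An inequality between sums of probabilities follows by counting at almost every point how many of
  the events occur.
\<close>

lemma sum_list_prob_mono:
  assumes "list_all (Measurable.pred M) Ps" "list_all (Measurable.pred M) Qs"
    and "AE \<omega> in M. (\<Sum>P\<leftarrow>Ps. of_bool (P \<omega>)) \<le> (\<Sum>Q\<leftarrow>Qs. of_bool (Q \<omega>) :: real)"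
  shows "(\<Sum>P\<leftarrow>Ps. \<P>(\<omega> in M. P \<omega>)) \<le> (\<Sum>Q\<leftarrow>Qs. \<P>(\<omega> in M. Q \<omega>))"
  using assms(1,2)[THEN sum_list_prob_eq_expectation] assms(3) by (auto intro: integral_mono_AE)

lemma prob_le_sum_list:
  assumes "Measurable.pred M P" "list_all (Measurable.pred M) Qs"
    and "\<And>\<omega>. P \<omega> \<Longrightarrow> list_ex (\<lambda>Q. Q \<omega>) Qs"
  shows "\<P>(\<omega> in M. P \<omega>) \<le> (\<Sum>Q\<leftarrow>Qs. \<P>(\<omega> in M. Q \<omega>))"
proof -
  have "of_bool (list_ex (\<lambda>Q. Q \<omega>) Qs) \<le> (\<Sum>Q\<leftarrow>Qs. of_bool (Q \<omega>) :: real)" for \<omega>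
    by (induction Qs) (auto split: if_splits intro: sum_list_nonneg)
  moreover have "of_bool (P \<omega>) \<le> (of_bool (list_ex (\<lambda>Q. Q \<omega>) Qs) :: real)" for \<omega>
    using assms(3) by simp
  ultimately have "of_bool (P \<omega>) \<le> (\<Sum>Q\<leftarrow>Qs. of_bool (Q \<omega>) :: real)" for \<omega>
    by (meson order_trans)
  then show ?thesis
    using sum_list_prob_mono[of "[P]" Qs] assms(1,2) by simp
qed

lemma consistently_varying_tail_stable:
  assumes [measurable]: "X \<in> borel_measurable M"
    and cv: "consistently_varying (distr M borel X)"
  shows "dilation_stable (at_left 1) scaleR at_top (\<lambda>x. \<P>(\<omega> in M. X \<omega> > x))"
    and "\<And>x. x \<ge> 0 \<Longrightarrow> \<P>(\<omega> in M. X \<omega> > x) > 0"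
proof -
  show pos: "\<P>(\<omega> in M. X \<omega> > x) > 0" if "x \<ge> 0" for x
    using cv that by (simp add: consistently_varying_def tail_distr)
  show "dilation_stable (at_left 1) scaleR at_top (\<lambda>x. \<P>(\<omega> in M. X \<omega> > x))"
  proof (rule dilation_stable_if_limsup_ratio)
    show "((\<lambda>z. Limsup at_top (\<lambda>x. ereal (\<P>(\<omega> in M. X \<omega> > z *\<^sub>R x) / \<P>(\<omega> in M. X \<omega> > x)))) \<longlongrightarrow> 1) (at_left 1)"
      using cv by (simp add: consistently_varying_def tail_distr)
    show "\<forall>\<^sub>F x in at_top. \<P>(\<omega> in M. X \<omega> > x) > 0"
      using eventually_ge_at_top[of 0] by eventually_elim (rule pos)
  qed
qed

lemma consistently_varyingI:
  assumes [measurable]: "X \<in> borel_measurable M"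
    and pos: "\<And>x. x \<ge> 0 \<Longrightarrow> \<P>(\<omega> in M. X \<omega> > x) > 0"
    and stable: "dilation_stable (at_left 1) scaleR at_top (\<lambda>x. \<P>(\<omega> in M. X \<omega> > x))"
  shows "consistently_varying (distr M borel X)"
proof -
  have "((\<lambda>z. Limsup at_top (\<lambda>x. ereal (\<P>(\<omega> in M. X \<omega> > z *\<^sub>R x) / \<P>(\<omega> in M. X \<omega> > x)))) \<longlongrightarrow> 1) (at_left 1)"
    using stable
  proof (rule limsup_ratio_if_dilation_stable)
    show "\<forall>\<^sub>F x in at_top. \<P>(\<omega> in M. X \<omega> > x) > 0"
      using eventually_ge_at_top[of 0] by eventually_elim (rule pos)
    have "\<forall>\<^sub>F z in at_left (1::real). z \<in> {0<..<1}"
      by (rule eventually_at_left_real) simp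
    then show "\<forall>\<^sub>F z in at_left 1. \<forall>\<^sub>F x in at_top.
        \<P>(\<omega> in M. X \<omega> > x) \<le> \<P>(\<omega> in M. X \<omega> > z *\<^sub>R x)"
    proof eventually_elim
      case (elim z)
      show ?case
        using eventually_ge_at_top[of 0]
      proof eventually_elim
        case (elim x)
        then have "z * x \<le> x"
          using \<open>z \<in> {0<..<1}\<close> by (simp add: mult_left_le_one_le)
        then show ?case by (intro finite_measure_mono) auto
      qed
    qed
  qed simp
  then show ?thesis
    using pos by (simp add: consistently_varying_def tail_distr real_distribution_distr)
qed

end

section \<open>The sum of two tail asymptotically independent variables\<close>

lemma filterlim_scaleR_at_top:
  "z > 0 \<Longrightarrow> filterlim (scaleR z) at_top (at_top :: real filter)"
  unfolding real_scaleR_def[abs_def]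
  by (intro filterlim_tendsto_pos_mult_at_top[OF tendsto_const] filterlim_ident)

text \<open>
  A single big jump: if neither summand exceeds \<open>z x\<close>, each must make up the remaining
  \<open>(1 - z) x\<close>.
\<close>

lemma real_sum_gt_split:
  fixes a b x z c :: real
  assumes "a + b > x" "z < 1" "c \<le> z" "c \<le> 1 - z" "x \<ge> 0"
  shows "a > z * x \<or> b > z * x \<or> (a > c * x \<and> b > c * x)"
proof -
  have "c * x \<le> (1 - z) * x" using assms by (intro mult_right_mono)
  then show ?thesis using assms by (auto simp: algebra_simps)
qed

context prob_space
begin

text \<open>
  This provides the marginal distributions of the sums.  The tail of \<open>X + Y\<close> is asymptotically
  equivalent to the sum of the two tails, since joint exceedances are negligible, and so inherits
  their stability.
\<close>

lemma consistently_varying_add_if_TAI: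
  assumes [measurable]: "X \<in> borel_measurable M" "Y \<in> borel_measurable M"
    and nn: "AE \<omega> in M. X \<omega> \<ge> 0" "AE \<omega> in M. Y \<omega> \<ge> 0"
    and cv: "consistently_varying (distr M borel X)" "consistently_varying (distr M borel Y)"
    and tai: "((\<lambda>(x, y). \<P>(\<omega> in M. \<bar>X \<omega>\<bar> > x \<bar> Y \<omega> > y)) \<longlongrightarrow> 0) (at_top \<times>\<^sub>F at_top)"
  shows "consistently_varying (distr M borel (\<lambda>\<omega>. X \<omega> + Y \<omega>))"
proof -
  define S where "S x = \<P>(\<omega> in M. X \<omega> + Y \<omega> > x)" for x
  define T where "T x = \<P>(\<omega> in M. X \<omega> > x) + \<P>(\<omega> in M. Y \<omega> > x)" for x
  \<comment> \<open>The absolute value matches the numerator in the asymptotic independence and only enlarges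
    the event, which is harmless for an error term.\<close>
  define E where "E x = \<P>(\<omega> in M. \<bar>X \<omega>\<bar> > x \<and> Y \<omega> > x)" for x
  note cvX = consistently_varying_tail_stable[OF assms(1) cv(1)]
  note cvY = consistently_varying_tail_stable[OF assms(2) cv(2)]
  have Tpos: "T x > 0" if "x \<ge> 0" for x
    using cvX(2)[OF that] cvY(2)[OF that] by (simp add: T_def)
  have ev_Tpos: "\<forall>\<^sub>F x in at_top. T x > 0"
    using eventually_ge_at_top[of 0] by eventually_elim (rule Tpos)
  have stable: "dilation_stable (at_left 1) scaleR at_top T"
    unfolding T_def by (rule dilation_stable_add[OF cvX(1) cvY(1)])
  have "E \<in> o[at_top](\<lambda>x. \<P>(\<omega> in M. Y \<omega> > x))"
  proof (rule smalloI_tendsto)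
    have "filterlim (\<lambda>x::real. (x, x)) (at_top \<times>\<^sub>F at_top) at_top"
      by (intro filterlim_Pair filterlim_ident)
    from filterlim_compose[OF tai this]
    show "((\<lambda>x. E x / \<P>(\<omega> in M. Y \<omega> > x)) \<longlongrightarrow> 0) at_top"
      by (simp add: cond_prob_def E_def)
    show "\<forall>\<^sub>F x in at_top. \<P>(\<omega> in M. Y \<omega> > x) \<noteq> 0"
      using eventually_ge_at_top[of 0] by eventually_elim (use cvY(2) in force)
  qed
  also have "(\<lambda>x. \<P>(\<omega> in M. Y \<omega> > x)) \<in> O[at_top](T)"
    by (intro bigoI[of _ 1] always_eventually) (simp add: T_def)
  finally have small: "E \<in> o[at_top](T)" .
  have lower: "T x \<le> S x + E x" if "x \<ge> 0" for x
  proof -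
    have "(\<Sum>P\<leftarrow>[\<lambda>\<omega>. X \<omega> > x, \<lambda>\<omega>. Y \<omega> > x]. \<P>(\<omega> in M. P \<omega>))
        \<le> (\<Sum>Q\<leftarrow>[\<lambda>\<omega>. X \<omega> + Y \<omega> > x, \<lambda>\<omega>. \<bar>X \<omega>\<bar> > x \<and> Y \<omega> > x]. \<P>(\<omega> in M. Q \<omega>))"
      using nn that by (intro sum_list_prob_mono) auto
    then show ?thesis by (simp add: T_def S_def E_def)
  qed
  have upper: "S x \<le> T (z *\<^sub>R x) + E (c *\<^sub>R x)"
    if "z < 1" "c \<le> z" "c \<le> 1 - z" "x \<ge> 0" for z c x
  proof -
    have "S x \<le> (\<Sum>Q\<leftarrow>[\<lambda>\<omega>. X \<omega> > z * x, \<lambda>\<omega>. Y \<omega> > z * x, \<lambda>\<omega>. \<bar>X \<omega>\<bar> > c * x \<and> Y \<omega> > c * x].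
        \<P>(\<omega> in M. Q \<omega>))"
      unfolding S_def
    proof (rule prob_le_sum_list)
      fix \<omega> assume "X \<omega> + Y \<omega> > x"
      from real_sum_gt_split[OF this that]
      show "list_ex (\<lambda>Q. Q \<omega>)
          [\<lambda>\<omega>. X \<omega> > z * x, \<lambda>\<omega>. Y \<omega> > z * x, \<lambda>\<omega>. \<bar>X \<omega>\<bar> > c * x \<and> Y \<omega> > c * x]"
        by auto
    qed simp_all
    then show ?thesis by (simp add: T_def E_def)
  qed
  have "S \<sim>[at_top] T"
  proof (rule asymp_equiv_if_dilation_sandwich[OF filterlim_scaleR_at_top ev_Tpos stable small])
    show "\<forall>\<^sub>F x in at_top. T x \<le> S x + E x"
      using eventually_ge_at_top[of 0] by eventually_elim (rule lower)
    show "\<forall>\<^sub>F x in at_top. S x \<le> T (z *\<^sub>R x) + E (c *\<^sub>R x)"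
      if "z < 1" "c \<le> z" "c \<le> 1 - z" for z c
      using eventually_ge_at_top[of 0] by eventually_elim (rule upper[OF that])
  qed
  moreover have "\<forall>\<^sub>F z :: real in at_left 1. filterlim (scaleR z) at_top (at_top :: real filter)"
    using eventually_at_left_real[of 0 "1::real"]
    by (auto elim!: eventually_mono intro: filterlim_scaleR_at_top)
  ultimately have "dilation_stable (at_left 1) scaleR at_top S"
    by (intro dilation_stable_asymp_equiv[OF _ ev_Tpos _ stable])
  moreover have "S x > 0" if "x \<ge> 0" for x
  proof -
    have "\<P>(\<omega> in M. X \<omega> > x) \<le> S x"
      unfolding S_def using nn by (intro finite_measure_mono_AE) auto
    with cvX(2)[OF that] show ?thesis by linarith
  qed
  ultimately show ?thesis
    unfolding S_def by (intro consistently_varyingI) auto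
qed

end

section \<open>Joint tails\<close>

definition pair_dilate :: "real \<times> real \<Rightarrow> real \<times> real \<Rightarrow> real \<times> real" where
  "pair_dilate z p = (fst z * fst p, snd z * snd p)"

lemma filterlim_pair_dilate:
  assumes "fst z > 0" "snd z > 0"
  shows "filterlim (pair_dilate z) (at_top \<times>\<^sub>F at_top) (at_top \<times>\<^sub>F at_top)"
  unfolding pair_dilate_def
  using assms
  by (intro filterlim_Pair filterlim_tendsto_pos_mult_at_top[OF tendsto_const]
      filterlim_fst filterlim_snd)

lemma eventually_prod_at_top_nonneg:
  "\<forall>\<^sub>F p in at_top \<times>\<^sub>F at_top. fst p \<ge> (0::real) \<and> snd p \<ge> (0::real)"
  by (auto simp: case_prod_beta intro!: eventually_conj
      eventually_compose_filterlim[OF eventually_ge_at_top filterlim_fst]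
      eventually_compose_filterlim[OF eventually_ge_at_top filterlim_snd])

lemma eventually_prod_at_left_1:
  "\<forall>\<^sub>F z in at_left 1 \<times>\<^sub>F at_left 1. fst z \<in> {0<..<1::real} \<and> snd z \<in> {0<..<1::real}"
  using eventually_compose_filterlim[OF eventually_at_left_real filterlim_fst, of "0::real" 1 "at_left 1"]
    eventually_compose_filterlim[OF eventually_at_left_real filterlim_snd, of "0::real" 1 "at_left 1"]
  by (intro eventually_conj) auto

text \<open>
  The class of pairs allows a separate factor for each coordinate, whereas the sandwich uses one
  common factor; the latter is the restriction to the diagonal.
\<close>

lemma dilation_stable_scaleR_if_pair_dilate:
  assumes "dilation_stable (at_left 1 \<times>\<^sub>F at_left 1) pair_dilate \<F> T"
  shows "dilation_stable (at_left 1) scaleR \<F> T"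
  unfolding dilation_stable_def
proof (intro allI impI)
  fix e :: real assume "e > 0"
  with assms have "\<forall>\<^sub>F z in at_left 1 \<times>\<^sub>F at_left 1. \<forall>\<^sub>F p in \<F>. T (pair_dilate z p) \<le> (1 + e) * T p"
    by (simp add: dilation_stable_def)
  moreover have "filterlim (\<lambda>z::real. (z, z)) (at_left 1 \<times>\<^sub>F at_left 1) (at_left 1)"
    by (intro filterlim_Pair filterlim_ident)
  ultimately have "\<forall>\<^sub>F z in at_left 1. \<forall>\<^sub>F p in \<F>. T (pair_dilate (z, z) p) \<le> (1 + e) * T p"
    by (rule eventually_compose_filterlim)
  then show "\<forall>\<^sub>F z in at_left 1. \<forall>\<^sub>F p in \<F>. T (z *\<^sub>R p) \<le> (1 + e) * T p"
    by (simp add: pair_dilate_def scaleR_prod_def)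
qed

lemma consistently_varying2_joint_tail_stable:
  assumes "consistently_varying2 M X Y"
  shows "dilation_stable (at_left 1 \<times>\<^sub>F at_left 1) pair_dilate (at_top \<times>\<^sub>F at_top)
           (\<lambda>p. joint_tail M X Y (fst p) (snd p))"
proof (rule dilation_stable_if_limsup_ratio)
  show "((\<lambda>z. Limsup (at_top \<times>\<^sub>F at_top) (\<lambda>p. ereal
      (joint_tail M X Y (fst (pair_dilate z p)) (snd (pair_dilate z p))
        / joint_tail M X Y (fst p) (snd p)))) \<longlongrightarrow> 1) (at_left 1 \<times>\<^sub>F at_left 1)"
    using assms by (simp add: consistently_varying2_def case_prod_unfold pair_dilate_def)
  show "\<forall>\<^sub>F p in at_top \<times>\<^sub>F at_top. joint_tail M X Y (fst p) (snd p) > 0"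
    using eventually_prod_at_top_nonneg assms
    by (auto simp: consistently_varying2_def elim!: eventually_mono)
qed

lemma (in prob_space) consistently_varying2I:
  assumes [measurable]: "X \<in> borel_measurable M" "Y \<in> borel_measurable M"
    and "consistently_varying (distr M borel X)" "consistently_varying (distr M borel Y)"
    and pos: "\<And>x y. x \<ge> 0 \<Longrightarrow> y \<ge> 0 \<Longrightarrow> joint_tail M X Y x y > 0"
    and stable: "dilation_stable (at_left 1 \<times>\<^sub>F at_left 1) pair_dilate (at_top \<times>\<^sub>F at_top)
           (\<lambda>p. joint_tail M X Y (fst p) (snd p))"
  shows "consistently_varying2 M X Y"
proof -
  have "((\<lambda>z. Limsup (at_top \<times>\<^sub>F at_top) (\<lambda>p. ereal
      (joint_tail M X Y (fst (pair_dilate z p)) (snd (pair_dilate z p))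
        / joint_tail M X Y (fst p) (snd p)))) \<longlongrightarrow> 1) (at_left 1 \<times>\<^sub>F at_left 1)"
    using stable
  proof (rule limsup_ratio_if_dilation_stable)
    show "\<forall>\<^sub>F p in at_top \<times>\<^sub>F at_top. joint_tail M X Y (fst p) (snd p) > 0"
      using eventually_prod_at_top_nonneg by eventually_elim (simp add: pos)
    show "\<forall>\<^sub>F z in at_left 1 \<times>\<^sub>F at_left 1. \<forall>\<^sub>F p in at_top \<times>\<^sub>F at_top.
       joint_tail M X Y (fst p) (snd p)
         \<le> joint_tail M X Y (fst (pair_dilate z p)) (snd (pair_dilate z p))"
      using eventually_prod_at_left_1
    proof eventually_elim
      case (elim z)
      show ?case
        using eventually_prod_at_top_nonneg
      proof eventually_elim
        case (elim p)
        then have "fst z * fst p \<le> fst p" "snd z * snd p \<le> snd p"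
          using \<open>fst z \<in> _ \<and> snd z \<in> _\<close> by (auto simp: mult_left_le_one_le)
        then show ?case
          unfolding joint_tail_def pair_dilate_def by (intro finite_measure_mono) auto
      qed
    qed
  qed (simp add: prod_filter_eq_bot)
  then show ?thesis
    using assms by (simp add: consistently_varying2_def case_prod_unfold pair_dilate_def)
qed

section \<open>The sum of two generalized tail asymptotically independent pairs\<close>

(* The indices 1 and 2 stay literal, so that facts about X 1 and Y 1 remain applicable. *)
declare One_nat_def [simp del]

context prob_space
begin

definition joint_tail_sum ::
  "(nat \<Rightarrow> 'a \<Rightarrow> real) \<Rightarrow> (nat \<Rightarrow> 'a \<Rightarrow> real) \<Rightarrow> real \<times> real \<Rightarrow> real" where
  "joint_tail_sum X Y p = (\<Sum>k=1..2. \<Sum>l=1..2. joint_tail M (X k) (Y l) (fst p) (snd p))"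

text \<open>
  Two exceedances in one coordinate and at least one in the other.  The absolute values match the
  numerators in the definition of asymptotic independence.
\<close>

definition joint_tail_overlap ::
  "(nat \<Rightarrow> 'a \<Rightarrow> real) \<Rightarrow> (nat \<Rightarrow> 'a \<Rightarrow> real) \<Rightarrow> real \<times> real \<Rightarrow> real" where
  "joint_tail_overlap X Y p =
     (\<Sum>l=1..2. \<P>(\<omega> in M. \<bar>X 1 \<omega>\<bar> > fst p \<and> X 2 \<omega> > fst p \<and> Y l \<omega> > snd p)) +
     (\<Sum>k=1..2. \<P>(\<omega> in M. \<bar>Y 1 \<omega>\<bar> > snd p \<and> X k \<omega> > fst p \<and> Y 2 \<omega> > snd p))"

lemma atLeastAtMost_1_2: "{1..2::nat} = {1, 2}"
  by auto

text \<open>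
  If \<open>a\<close> of the \<open>X k\<close> exceed \<open>x\<close> and \<open>b\<close> of the \<open>Y l\<close> exceed \<open>y\<close>, the left-hand side counts the
  point \<open>a b\<close> times.  When \<open>a, b \<ge> 1\<close>, both sums exceed their levels because the other summands
  are non-negative, and the overlap counts the point at least \<open>a b - 1\<close> times: once for
  \<open>{a, b} = {1, 2}\<close> and four times for \<open>a = b = 2\<close>.
\<close>

lemma joint_tail_sum_le:
  assumes [measurable]: "X 1 \<in> borel_measurable M" "X 2 \<in> borel_measurable M"
      "Y 1 \<in> borel_measurable M" "Y 2 \<in> borel_measurable M"
    and nn: "AE \<omega> in M. X 1 \<omega> \<ge> 0" "AE \<omega> in M. X 2 \<omega> \<ge> 0"
      "AE \<omega> in M. Y 1 \<omega> \<ge> 0" "AE \<omega> in M. Y 2 \<omega> \<ge> 0"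
  shows "joint_tail_sum X Y (x, y)
    \<le> joint_tail M (\<lambda>\<omega>. X 1 \<omega> + X 2 \<omega>) (\<lambda>\<omega>. Y 1 \<omega> + Y 2 \<omega>) x y + joint_tail_overlap X Y (x, y)"
proof -
  let ?Ps = "[\<lambda>\<omega>. X 1 \<omega> > x \<and> Y 1 \<omega> > y, \<lambda>\<omega>. X 1 \<omega> > x \<and> Y 2 \<omega> > y,
    \<lambda>\<omega>. X 2 \<omega> > x \<and> Y 1 \<omega> > y, \<lambda>\<omega>. X 2 \<omega> > x \<and> Y 2 \<omega> > y]"
  let ?Qs = "[\<lambda>\<omega>. X 1 \<omega> + X 2 \<omega> > x \<and> Y 1 \<omega> + Y 2 \<omega> > y,
    \<lambda>\<omega>. \<bar>X 1 \<omega>\<bar> > x \<and> X 2 \<omega> > x \<and> Y 1 \<omega> > y, \<lambda>\<omega>. \<bar>X 1 \<omega>\<bar> > x \<and> X 2 \<omega> > x \<and> Y 2 \<omega> > y,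
    \<lambda>\<omega>. \<bar>Y 1 \<omega>\<bar> > y \<and> X 1 \<omega> > x \<and> Y 2 \<omega> > y, \<lambda>\<omega>. \<bar>Y 1 \<omega>\<bar> > y \<and> X 2 \<omega> > x \<and> Y 2 \<omega> > y]"
  have "(\<Sum>P\<leftarrow>?Ps. \<P>(\<omega> in M. P \<omega>)) \<le> (\<Sum>Q\<leftarrow>?Qs. \<P>(\<omega> in M. Q \<omega>))"
  proof (rule sum_list_prob_mono)
    show "AE \<omega> in M. (\<Sum>P\<leftarrow>?Ps. of_bool (P \<omega>)) \<le> (\<Sum>Q\<leftarrow>?Qs. of_bool (Q \<omega>) :: real)"
      using nn
    proof eventually_elim
      case (elim \<omega>)
      then have *: "\<bar>X 1 \<omega>\<bar> = X 1 \<omega>" "\<bar>Y 1 \<omega>\<bar> = Y 1 \<omega>"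
        "X 1 \<omega> > x \<or> X 2 \<omega> > x \<Longrightarrow> X 1 \<omega> + X 2 \<omega> > x"
        "Y 1 \<omega> > y \<or> Y 2 \<omega> > y \<Longrightarrow> Y 1 \<omega> + Y 2 \<omega> > y"
        by auto
      show ?case
        by (cases "X 1 \<omega> > x"; cases "X 2 \<omega> > x"; cases "Y 1 \<omega> > y"; cases "Y 2 \<omega> > y")
          (simp_all add: *)
    qed
  qed simp_all
  then show ?thesis
    by (simp add: joint_tail_sum_def joint_tail_overlap_def joint_tail_def atLeastAtMost_1_2)
qed

text \<open>
  Splitting both sums into a big jump or two moderate ones, every combination other than a big jump
  in each coordinate has two moderate summands in one coordinate and one in the other.
\<close>

lemma joint_tail_of_sums_le:
  assumes [measurable]: "X 1 \<in> borel_measurable M" "X 2 \<in> borel_measurable M"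
      "Y 1 \<in> borel_measurable M" "Y 2 \<in> borel_measurable M"
    and zc: "z < 1" "c \<le> z" "c \<le> 1 - z" and xy: "x \<ge> 0" "y \<ge> 0"
  shows "joint_tail M (\<lambda>\<omega>. X 1 \<omega> + X 2 \<omega>) (\<lambda>\<omega>. Y 1 \<omega> + Y 2 \<omega>) x y
    \<le> joint_tail_sum X Y (z * x, z * y) + joint_tail_overlap X Y (c * x, c * y)"
proof -
  let ?Qs = "[\<lambda>\<omega>. X 1 \<omega> > z * x \<and> Y 1 \<omega> > z * y, \<lambda>\<omega>. X 1 \<omega> > z * x \<and> Y 2 \<omega> > z * y,
    \<lambda>\<omega>. X 2 \<omega> > z * x \<and> Y 1 \<omega> > z * y, \<lambda>\<omega>. X 2 \<omega> > z * x \<and> Y 2 \<omega> > z * y,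
    \<lambda>\<omega>. \<bar>X 1 \<omega>\<bar> > c * x \<and> X 2 \<omega> > c * x \<and> Y 1 \<omega> > c * y,
    \<lambda>\<omega>. \<bar>X 1 \<omega>\<bar> > c * x \<and> X 2 \<omega> > c * x \<and> Y 2 \<omega> > c * y,
    \<lambda>\<omega>. \<bar>Y 1 \<omega>\<bar> > c * y \<and> X 1 \<omega> > c * x \<and> Y 2 \<omega> > c * y,
    \<lambda>\<omega>. \<bar>Y 1 \<omega>\<bar> > c * y \<and> X 2 \<omega> > c * x \<and> Y 2 \<omega> > c * y]"
  have le: "c * x \<le> z * x" "c * y \<le> z * y" using xy zc by (auto intro: mult_right_mono)
  have "joint_tail M (\<lambda>\<omega>. X 1 \<omega> + X 2 \<omega>) (\<lambda>\<omega>. Y 1 \<omega> + Y 2 \<omega>) x y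
      \<le> (\<Sum>Q\<leftarrow>?Qs. \<P>(\<omega> in M. Q \<omega>))"
    unfolding joint_tail_def
  proof (rule prob_le_sum_list)
    fix \<omega> assume sums: "X 1 \<omega> + X 2 \<omega> > x \<and> Y 1 \<omega> + Y 2 \<omega> > y"
    have X_split: "X 1 \<omega> > z * x \<or> X 2 \<omega> > z * x \<or> (X 1 \<omega> > c * x \<and> X 2 \<omega> > c * x)"
      by (rule real_sum_gt_split[OF conjunct1[OF sums] zc xy(1)])
    have Y_split: "Y 1 \<omega> > z * y \<or> Y 2 \<omega> > z * y \<or> (Y 1 \<omega> > c * y \<and> Y 2 \<omega> > c * y)"
      by (rule real_sum_gt_split[OF conjunct2[OF sums] zc xy(2)])
    \<comment> \<open>When one coordinate has a summand above the high level and the other has two above the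
      low level, lowering the first level leaves an overlap event.\<close>
    have level: "X k \<omega> > z * x \<Longrightarrow> X k \<omega> > c * x" "Y k \<omega> > z * y \<Longrightarrow> Y k \<omega> > c * y"
      "X k \<omega> > c * x \<Longrightarrow> \<bar>X k \<omega>\<bar> > c * x" "Y k \<omega> > c * y \<Longrightarrow> \<bar>Y k \<omega>\<bar> > c * y" for k
      using le by auto
    from X_split Y_split show "list_ex (\<lambda>Q. Q \<omega>) ?Qs"
      unfolding list_ex_Cons_iff list_ex_Nil_iff
      by (elim disjE conjE) (simp_all only: level simp_thms)
  qed simp_all
  then show ?thesis
    by (simp add: joint_tail_sum_def joint_tail_overlap_def joint_tail_def atLeastAtMost_1_2)
qed

lemma joint_tail_in_bigo_joint_tail_sum:
  assumes "k \<in> {1..2}" "l \<in> {1..2}"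
  shows "(\<lambda>p. joint_tail M (X k) (Y l) (fst p) (snd p)) \<in> O[\<F>](joint_tail_sum X Y)"
proof (intro bigoI[of _ 1] always_eventually allI)
  fix p
  let ?J = "\<lambda>k l. joint_tail M (X k) (Y l) (fst p) (snd p)"
  have nonneg: "?J k l \<ge> 0" for k l by (simp add: joint_tail_def)
  have "?J k l \<le> (\<Sum>l=1..2. ?J k l)"
    using assms nonneg by (intro member_le_sum) auto
  also have "\<dots> \<le> joint_tail_sum X Y p"
    unfolding joint_tail_sum_def
    using assms nonneg
    by (intro member_le_sum[where f = "\<lambda>k. \<Sum>l=1..2. ?J k l"] sum_nonneg) auto
  finally show "norm (?J k l) \<le> 1 * norm (joint_tail_sum X Y p)"
    using nonneg[of k l] by simp
qed

text \<open>
  Each overlap probability divided by the joint tail of two of the three variables involved is one of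
  the conditional probabilities that vanish by assumption, taken along equal levels for the
  variables of the same coordinate.
\<close>

lemma joint_tail_overlap_smallo:
  assumes gtai: "GTAI M 2 X 2 Y"
  shows "joint_tail_overlap X Y \<in> o[at_top \<times>\<^sub>F at_top](joint_tail_sum X Y)"
proof -
  let ?F = "at_top \<times>\<^sub>F at_top :: (real \<times> real) filter"
  define J where "J k l p = joint_tail M (X k) (Y l) (fst p) (snd p)" for k l p
  define A where "A l p = \<P>(\<omega> in M. \<bar>X 1 \<omega>\<bar> > fst p \<and> X 2 \<omega> > fst p \<and> Y l \<omega> > snd p)" for l p
  define B where "B k p = \<P>(\<omega> in M. \<bar>Y 1 \<omega>\<bar> > snd p \<and> X k \<omega> > fst p \<and> Y 2 \<omega> > snd p)" for k p
  have smallo: "f \<in> o[?F](joint_tail_sum X Y)"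
    if "k \<in> {1..2}" "l \<in> {1..2}" and lim: "((\<lambda>p. f p / J k l p) \<longlongrightarrow> 0) ?F" for f k l
  proof -
    have "\<forall>\<^sub>F p in ?F. J k l p \<noteq> 0"
      using eventually_prod_at_top_nonneg
    proof eventually_elim
      case (elim p)
      then have "J k l p > 0"
        using gtai that(1,2) unfolding GTAI_def J_def joint_tail_def by blast
      then show ?case by simp
    qed
    with lim have "f \<in> o[?F](J k l)" by (rule smalloI_tendsto)
    also have "J k l \<in> O[?F](joint_tail_sum X Y)"
      unfolding J_def using that(1,2) by (rule joint_tail_in_bigo_joint_tail_sum)
    finally show ?thesis .
  qed
  have "A l \<in> o[?F](joint_tail_sum X Y)" if l: "l \<in> {1..2}" for l
  proof (rule smallo)
    have lim: "((\<lambda>(x\<^sub>i, x\<^sub>k, y\<^sub>j). \<P>(\<omega> in M. \<bar>X 1 \<omega>\<bar> > x\<^sub>i \<bar> X 2 \<omega> > x\<^sub>k \<and> Y l \<omega> > y\<^sub>j)) \<longlongrightarrow> 0)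
        (at_top \<times>\<^sub>F at_top \<times>\<^sub>F at_top)"
      using gtai l by (simp add: GTAI_def)
    have "filterlim (\<lambda>p::real \<times> real. (fst p, fst p, snd p))
        (at_top \<times>\<^sub>F at_top \<times>\<^sub>F at_top) ?F"
      by (intro filterlim_Pair filterlim_fst filterlim_snd)
    from filterlim_compose[OF lim this]
    show "((\<lambda>p. A l p / J 2 l p) \<longlongrightarrow> 0) ?F"
      unfolding A_def J_def joint_tail_def cond_prob_def
      by (simp add: case_prod_unfold)
  qed (use l in auto)
  moreover have "B k \<in> o[?F](joint_tail_sum X Y)" if k: "k \<in> {1..2}" for k
  proof (rule smallo)
    have lim: "((\<lambda>(x\<^sub>i, y\<^sub>k, y\<^sub>j). \<P>(\<omega> in M. \<bar>Y 1 \<omega>\<bar> > y\<^sub>j \<bar> X k \<omega> > x\<^sub>i \<and> Y 2 \<omega> > y\<^sub>k)) \<longlongrightarrow> 0)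
        (at_top \<times>\<^sub>F at_top \<times>\<^sub>F at_top)"
      using gtai k by (simp add: GTAI_def)
    have "filterlim (\<lambda>p::real \<times> real. (fst p, snd p, snd p))
        (at_top \<times>\<^sub>F at_top \<times>\<^sub>F at_top) ?F"
      by (intro filterlim_Pair filterlim_fst filterlim_snd)
    from filterlim_compose[OF lim this]
    show "((\<lambda>p. B k p / J k 2 p) \<longlongrightarrow> 0) ?F"
      unfolding B_def J_def joint_tail_def cond_prob_def
      by (simp add: case_prod_unfold)
  qed (use k in auto)
  ultimately have "(\<lambda>p. (\<Sum>l=1..2. A l p) + (\<Sum>k=1..2. B k p)) \<in> o[?F](joint_tail_sum X Y)"
    by (intro sum_in_smallo big_sum_in_smallo)
  then show ?thesis
    by (simp add: joint_tail_overlap_def[abs_def] A_def B_def)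
qed

end

theorem corollary4p1:
  fixes M :: "'a measure" and X Y :: "nat \<Rightarrow> 'a \<Rightarrow> real"
  assumes "prob_space M"
    and "\<And>k. k \<in> {1..2} \<Longrightarrow> X k \<in> borel_measurable M"
    and "\<And>l. l \<in> {1..2} \<Longrightarrow> Y l \<in> borel_measurable M"
    and "\<And>k. k \<in> {1..2} \<Longrightarrow> AE \<omega> in M. X k \<omega> \<ge> 0"
    and "\<And>l. l \<in> {1..2} \<Longrightarrow> AE \<omega> in M. Y l \<omega> \<ge> 0"
    and "\<And>k. k \<in> {1..2} \<Longrightarrow> consistently_varying (distr M borel (X k))"
    and "\<And>l. l \<in> {1..2} \<Longrightarrow> consistently_varying (distr M borel (Y l))"
    and "GTAI M 2 X 2 Y"
    and "\<And>k l. k \<in> {1..2} \<Longrightarrow> l \<in> {1..2} \<Longrightarrow> consistently_varying2 M (X k) (Y l)"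
  shows "(\<lambda>(x, y). \<P>(\<omega> in M. X 1 \<omega> + X 2 \<omega> > x \<and> Y 1 \<omega> + Y 2 \<omega> > y))
           \<sim>[at_top \<times>\<^sub>F at_top]
         (\<lambda>(x, y). \<Sum>k=1..2. \<Sum>l=1..2. \<P>(\<omega> in M. X k \<omega> > x \<and> Y l \<omega> > y))
       \<and> (TAI M 2 X \<and> TAI M 2 Y \<longrightarrow>
           consistently_varying2 M (\<lambda>\<omega>. X 1 \<omega> + X 2 \<omega>) (\<lambda>\<omega>. Y 1 \<omega> + Y 2 \<omega>))"
proof -
  interpret prob_space M by (rule assms(1))
  have [measurable]: "X 1 \<in> borel_measurable M" "X 2 \<in> borel_measurable M"
    "Y 1 \<in> borel_measurable M" "Y 2 \<in> borel_measurable M"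
    using assms(2,3) by auto
  have nn: "AE \<omega> in M. X 1 \<omega> \<ge> 0" "AE \<omega> in M. X 2 \<omega> \<ge> 0"
    "AE \<omega> in M. Y 1 \<omega> \<ge> 0" "AE \<omega> in M. Y 2 \<omega> \<ge> 0"
    using assms(4,5) by auto
  let ?F = "at_top \<times>\<^sub>F at_top :: (real \<times> real) filter"
  define S where "S p = joint_tail M (\<lambda>\<omega>. X 1 \<omega> + X 2 \<omega>) (\<lambda>\<omega>. Y 1 \<omega> + Y 2 \<omega>) (fst p) (snd p)" for p
  let ?T = "joint_tail_sum X Y" and ?E = "joint_tail_overlap X Y"
  have Jpos: "joint_tail M (X k) (Y l) x y > 0"
    if "k \<in> {1..2}" "l \<in> {1..2}" "x \<ge> 0" "y \<ge> 0" for k l x y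
    using assms(9)[OF that(1,2)] that(3,4) by (simp add: consistently_varying2_def)
  have ev_Tpos: "\<forall>\<^sub>F p in ?F. ?T p > 0"
    using eventually_prod_at_top_nonneg
  proof eventually_elim
    case (elim p)
    then show ?case
      unfolding joint_tail_sum_def using Jpos by (intro sum_pos) auto
  qed
  have stable: "dilation_stable (at_left 1 \<times>\<^sub>F at_left 1) pair_dilate ?F ?T"
    unfolding joint_tail_sum_def[abs_def]
    by (intro dilation_stable_sum consistently_varying2_joint_tail_stable assms(9))
  have equiv: "S \<sim>[?F] ?T"
  proof (rule asymp_equiv_if_dilation_sandwich
      [OF _ ev_Tpos dilation_stable_scaleR_if_pair_dilate[OF stable]
        joint_tail_overlap_smallo[OF assms(8)]])
    show "filterlim (scaleR z) ?F ?F" if "z > 0" for z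
      using filterlim_pair_dilate[of "(z, z)"] that
      by (simp add: pair_dilate_def[abs_def] scaleR_prod_def[abs_def])
    show "\<forall>\<^sub>F p in ?F. ?T p \<le> S p + ?E p"
      using joint_tail_sum_le[OF _ _ _ _ nn] by (intro always_eventually) (simp add: S_def)
    show "\<forall>\<^sub>F p in ?F. S p \<le> ?T (z *\<^sub>R p) + ?E (c *\<^sub>R p)"
      if zc: "z < 1" "c \<le> z" "c \<le> 1 - z" for z c
      using eventually_prod_at_top_nonneg
    proof eventually_elim
      case (elim p)
      then show ?case
        using joint_tail_of_sums_le[OF _ _ _ _ zc, of X Y "fst p" "snd p"]
        by (simp add: S_def scaleR_prod_def)
    qed
  qed
  have "consistently_varying2 M (\<lambda>\<omega>. X 1 \<omega> + X 2 \<omega>) (\<lambda>\<omega>. Y 1 \<omega> + Y 2 \<omega>)"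
    if "TAI M 2 X" "TAI M 2 Y"
  proof (rule consistently_varying2I)
    show "consistently_varying (distr M borel (\<lambda>\<omega>. X 1 \<omega> + X 2 \<omega>))"
      using assms(6) that(1) nn by (intro consistently_varying_add_if_TAI) (auto simp: TAI_def)
    show "consistently_varying (distr M borel (\<lambda>\<omega>. Y 1 \<omega> + Y 2 \<omega>))"
      using assms(7) that(2) nn by (intro consistently_varying_add_if_TAI) (auto simp: TAI_def)
    show "joint_tail M (\<lambda>\<omega>. X 1 \<omega> + X 2 \<omega>) (\<lambda>\<omega>. Y 1 \<omega> + Y 2 \<omega>) x y > 0"
      if "x \<ge> 0" "y \<ge> 0" for x y
    proof -
      have "joint_tail M (X 1) (Y 1) x y
          \<le> joint_tail M (\<lambda>\<omega>. X 1 \<omega> + X 2 \<omega>) (\<lambda>\<omega>. Y 1 \<omega> + Y 2 \<omega>) x y"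
        unfolding joint_tail_def using nn by (intro finite_measure_mono_AE) auto
      with Jpos[of 1 1 x y] that show ?thesis by simp
    qed
    have "\<forall>\<^sub>F z in at_left 1 \<times>\<^sub>F at_left 1. filterlim (pair_dilate z) ?F ?F"
      using eventually_prod_at_left_1 by eventually_elim (auto intro: filterlim_pair_dilate)
    from dilation_stable_asymp_equiv[OF equiv ev_Tpos this stable]
    show "dilation_stable (at_left 1 \<times>\<^sub>F at_left 1) pair_dilate ?F
        (\<lambda>p. joint_tail M (\<lambda>\<omega>. X 1 \<omega> + X 2 \<omega>) (\<lambda>\<omega>. Y 1 \<omega> + Y 2 \<omega>) (fst p) (snd p))"
      unfolding S_def .
  qed measurable
  moreover have "(\<lambda>(x, y). \<P>(\<omega> in M. X 1 \<omega> + X 2 \<omega> > x \<and> Y 1 \<omega> + Y 2 \<omega> > y)) = S"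
    and "(\<lambda>(x, y). \<Sum>k=1..2. \<Sum>l=1..2. \<P>(\<omega> in M. X k \<omega> > x \<and> Y l \<omega> > y)) = ?T"
    by (auto simp: fun_eq_iff S_def joint_tail_sum_def joint_tail_def)
  ultimately show ?thesis using equiv by simp
qed

end
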